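(* Let $X$ be a set and let $K:X\times X\to M_n(\mathbb{C})$ be a $\mathbb{C}^n$-reproducing kernel whose reproducing kernel Hilbert space $\mathcal{H}_K$ is separable. Let $\tau_K$ be the topology on $X$ induced by the pseudo-metric $d(x,t)=\sup_{y\in\mathbb{C}^n,\ \|y\|\le 1}\|K_xy-K_ty\|_K$. Then: (i) The space $X$ endowed with $\tau_K$ is second countable, and $K$ is continuous (on $X\times X$ with the product topology). (ii) If $\mathcal{A}$ is a $\sigma$-algebra on $X$ with respect to which $K$ is measurable, then the Borel $\sigma$-algebra $\mathcal{B}(X)$ generated by $\tau_K$ is contained in $\mathcal{A}$. (iii) If $\mathcal{A}$ is a $\sigma$-algebra on $X$ with respect to which $K$ is measurable and $\mu:\mathcal{A}\to[0,+\infty)$ is a finite measure, then there exists a unique $\tau_K$-closed set $C\subset X$ such that $\mu(C)=\mu(X)$ and such that every $\tau_K$-closed set $C'\subset X$ with $\mu(C')=\mu(X)$ satisfies $C'\supset C$.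
   Context: $n\ge 1$ is an integer; $\mathbb{C}^n$ has its Euclidean norm $\|\cdot\|$ and inner product $\langle\cdot,\cdot\rangle$ (linear in the first argument), canonical basis $e_1,\dots,e_n$, and $M_n(\mathbb{C})$ is the space of complex $n\times n$ matrices with the operator norm. A map $K:X\times X\to M_n(\mathbb{C})$ is a $\mathbb{C}^n$-reproducing kernel if $K(x,t)^*=K(t,x)$ for all $x,t\in X$, and $\sum_{i,j=1}^m\langle K(x_i,x_j)y_j,y_i\rangle\ge 0$ for all $m\ge1$, $x_1,\dots,x_m\in X$, $y_1,\dots,y_m\in\mathbb{C}^n$. For $x\in X$, $y\in\mathbb{C}^n$ let $K_xy:X\to\mathbb{C}^n$ be the function $(K_xy)(t)=K(t,x)y$, and $K_x^j=K_xe_j$. The associated reproducing kernel Hilbert space $\mathcal{H}_K$, with inner product $\langle\cdot,\cdot\rangle_K$ and norm $\|\cdot\|_K$, is the unique Hilbert space of functions $X\to\mathbb{C}^n$ containing all $K_x^j$ and such that $f(x)=(\langle f,K_x^1\rangle_K,\dots,\langle f,K_x^n\rangle_K)$ for all $f\in\mathcal{H}_K$, $x\in X$. The topology $\tau_K$ (in general not Hausdorff) has as a basis the balls $B(x,r)=\{t\in X: d(x,t)<r\}$, $x\in X$, $r>0$. "$K$ is measurable with respect to $\mathcal{A}$" means that $K$ is measurable on $X\times X$ with the product $\sigma$-algebra $\mathcal{A}\otimes\mathcal{A}$. *)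

theory Defs
  imports "HOL-Analysis.Analysis"
begin

definition cdot :: "complex ^ 'n \<Rightarrow> complex ^ 'n \<Rightarrow> complex" where
  "cdot u v = (\<Sum>i\<in>UNIV. u $ i * cnj (v $ i))"

definition conj_transpose :: "complex ^ 'n ^ 'n \<Rightarrow> complex ^ 'n ^ 'n" where
  "conj_transpose A = (\<chi> i j. cnj (A $ j $ i))"

definition reproducing_kernel :: "'x set \<Rightarrow> ('x \<Rightarrow> 'x \<Rightarrow> complex ^ 'n ^ 'n) \<Rightarrow> bool" where
  "reproducing_kernel X K \<longleftrightarrow>
     (\<forall>x\<in>X. \<forall>t\<in>X. conj_transpose (K x t) = K t x) \<and>
     (\<forall>m\<ge>1. \<forall>(x :: nat \<Rightarrow> 'x) (y :: nat \<Rightarrow> complex ^ 'n).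
        (\<forall>i\<in>{1..m}. x i \<in> X) \<longrightarrow>
        (\<Sum>i=1..m. \<Sum>j=1..m. cdot (K (x i) (x j) *v y j) (y i)) \<in> \<real>\<^sub>\<ge>\<^sub>0)"

text \<open>
  Functions from \<open>X\<close> to \<open>\<complex>\<^sup>n\<close> are encoded as total functions vanishing outside the carrier \<open>X\<close>,
  so that they are determined by their values on \<open>X\<close> and form a vector space under the
  pointwise operations.
\<close>

definition kernel_fun ::
    "'x set \<Rightarrow> ('x \<Rightarrow> 'x \<Rightarrow> complex ^ 'n ^ 'n) \<Rightarrow> 'x \<Rightarrow> complex ^ 'n \<Rightarrow> 'x \<Rightarrow> complex ^ 'n" where
  "kernel_fun X K x y = (\<lambda>t. if t \<in> X then K t x *v y else 0)"

definition ip_norm :: "(('x \<Rightarrow> complex ^ 'n) \<Rightarrow> ('x \<Rightarrow> complex ^ 'n) \<Rightarrow> complex) \<Rightarrow>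
    ('x \<Rightarrow> complex ^ 'n) \<Rightarrow> real" where
  "ip_norm ip f = sqrt (Re (ip f f))"

text \<open>
  The library's locale for metric spaces requires non-negativity and symmetry of the distance
  also outside the carrier, hence the case distinction.
\<close>

definition ip_dist :: "('x \<Rightarrow> complex ^ 'n) set \<Rightarrow>
    (('x \<Rightarrow> complex ^ 'n) \<Rightarrow> ('x \<Rightarrow> complex ^ 'n) \<Rightarrow> complex) \<Rightarrow>
    ('x \<Rightarrow> complex ^ 'n) \<Rightarrow> ('x \<Rightarrow> complex ^ 'n) \<Rightarrow> real" where
  "ip_dist H ip f g = (if f \<in> H \<and> g \<in> H then ip_norm ip (\<lambda>x. f x - g x) else 0)"

locale hilbert_function_space =
  fixes X :: "'x set"
    and H :: "('x \<Rightarrow> complex ^ 'n) set"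
    and ip :: "('x \<Rightarrow> complex ^ 'n) \<Rightarrow> ('x \<Rightarrow> complex ^ 'n) \<Rightarrow> complex"
  assumes outside: "\<And>f x. f \<in> H \<Longrightarrow> x \<notin> X \<Longrightarrow> f x = 0"
    and zero_mem: "(\<lambda>x. 0) \<in> H"
    and add_mem: "\<And>f g. f \<in> H \<Longrightarrow> g \<in> H \<Longrightarrow> (\<lambda>x. f x + g x) \<in> H"
    and scale_mem: "\<And>c f. f \<in> H \<Longrightarrow> (\<lambda>x. c *s f x) \<in> H"
    and ip_add_left: "\<And>f g h. f \<in> H \<Longrightarrow> g \<in> H \<Longrightarrow> h \<in> H \<Longrightarrow>
          ip (\<lambda>x. f x + g x) h = ip f h + ip g h"
    and ip_scale_left: "\<And>c f g. f \<in> H \<Longrightarrow> g \<in> H \<Longrightarrow> ip (\<lambda>x. c *s f x) g = c * ip f g"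
    and ip_cnj: "\<And>f g. f \<in> H \<Longrightarrow> g \<in> H \<Longrightarrow> ip g f = cnj (ip f g)"
    and ip_nonneg: "\<And>f. f \<in> H \<Longrightarrow> ip f f \<in> \<real>\<^sub>\<ge>\<^sub>0"
    and ip_definite: "\<And>f. f \<in> H \<Longrightarrow> ip f f = 0 \<Longrightarrow> f = (\<lambda>x. 0)"
    and complete: "Metric_space.mcomplete H (ip_dist H ip)"

text \<open>
  \<open>rkhs X H ip K\<close> says that \<open>H\<close> with inner product \<open>ip\<close> is the reproducing kernel Hilbert space
  of \<open>K\<close>. The values of \<open>ip\<close> outside \<open>H \<times> H\<close> are irrelevant.
\<close>

locale rkhs = hilbert_function_space X H ip
  for X :: "'x set"
    and H :: "('x \<Rightarrow> complex ^ 'n) set"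
    and ip :: "('x \<Rightarrow> complex ^ 'n) \<Rightarrow> ('x \<Rightarrow> complex ^ 'n) \<Rightarrow> complex" +
  fixes K :: "'x \<Rightarrow> 'x \<Rightarrow> complex ^ 'n ^ 'n"
  assumes kernel_fun_mem: "\<And>x j. x \<in> X \<Longrightarrow> kernel_fun X K x (axis j 1) \<in> H"
    and reproducing: "\<And>f x. f \<in> H \<Longrightarrow> x \<in> X \<Longrightarrow>
          f x = (\<chi> j. ip f (kernel_fun X K x (axis j 1)))"

definition kernel_dist :: "'x set \<Rightarrow> (('x \<Rightarrow> complex ^ 'n) \<Rightarrow> ('x \<Rightarrow> complex ^ 'n) \<Rightarrow> complex) \<Rightarrow>
    ('x \<Rightarrow> 'x \<Rightarrow> complex ^ 'n ^ 'n) \<Rightarrow> 'x \<Rightarrow> 'x \<Rightarrow> real" where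
  "kernel_dist X ip K x t =
     (SUP y\<in>{y. norm y \<le> 1}. ip_norm ip (\<lambda>s. kernel_fun X K x y s - kernel_fun X K t y s))"

definition kernel_ball :: "'x set \<Rightarrow> (('x \<Rightarrow> complex ^ 'n) \<Rightarrow> ('x \<Rightarrow> complex ^ 'n) \<Rightarrow> complex) \<Rightarrow>
    ('x \<Rightarrow> 'x \<Rightarrow> complex ^ 'n ^ 'n) \<Rightarrow> 'x \<Rightarrow> real \<Rightarrow> 'x set" where
  "kernel_ball X ip K x r = {t \<in> X. kernel_dist X ip K x t < r}"

definition kernel_topology :: "'x set \<Rightarrow> (('x \<Rightarrow> complex ^ 'n) \<Rightarrow> ('x \<Rightarrow> complex ^ 'n) \<Rightarrow> complex) \<Rightarrow>
    ('x \<Rightarrow> 'x \<Rightarrow> complex ^ 'n ^ 'n) \<Rightarrow> 'x topology" where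
  "kernel_topology X ip K =
     topology (arbitrary union_of (\<lambda>B. \<exists>x\<in>X. \<exists>r>0. B = kernel_ball X ip K x r))"

text \<open>
  The remaining facts show that the library's metric notions apply to \<open>H\<close> and that the balls
  are a basis of \<^const>\<open>kernel_topology\<close>.
\<close>

context hilbert_function_space
begin

lemma diff_mem:
  assumes "f \<in> H" "g \<in> H"
  shows "(\<lambda>x. f x - g x) \<in> H"
  using add_mem[OF assms(1) scale_mem[OF assms(2), of "-1"]] by (simp add: vec_eq_iff)

lemma ip_norm_nonneg: "f \<in> H \<Longrightarrow> 0 \<le> ip_norm ip f"
  using ip_nonneg[of f] by (auto simp: ip_norm_def nonneg_Reals_def)

lemma Re_ip_expand:
  fixes r :: real
  assumes f: "f \<in> H" and g: "g \<in> H"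
  shows "Re (ip (\<lambda>x. f x + of_real r *s g x) (\<lambda>x. f x + of_real r *s g x))
     = Re (ip f f) + 2 * r * Re (ip f g) + r^2 * Re (ip g g)"
proof -
  define h where "h = (\<lambda>x. f x + of_real r *s g x)"
  have rg: "(\<lambda>x. of_real r *s g x) \<in> H" using scale_mem[OF g] .
  have h: "h \<in> H" unfolding h_def using add_mem[OF f rg] .
  have e: "ip h k = ip f k + of_real r * ip g k" if "k \<in> H" for k
    unfolding h_def using ip_add_left[OF f rg that] ip_scale_left[OF g that] by simp
  have "ip h h = cnj (ip h f) + of_real r * cnj (ip h g)"
    using e[OF h] ip_cnj[OF h f] ip_cnj[OF h g] by simp
  also have "\<dots> = cnj (ip f f) + of_real r * cnj (ip g f)
      + of_real r * (cnj (ip f g) + of_real r * cnj (ip g g))"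
    using e[OF f] e[OF g] by simp
  finally show ?thesis
    using ip_cnj[OF f g] unfolding h_def[symmetric]
    by (simp add: algebra_simps power2_eq_square)
qed

lemma Cauchy_Schwarz_Re:
  assumes f: "f \<in> H" and g: "g \<in> H"
  shows "Re (ip f g) \<le> ip_norm ip f * ip_norm ip g"
proof -
  let ?a = "Re (ip g g)" and ?b = "Re (ip f g)" and ?c = "Re (ip f f)"
  have nn: "0 \<le> Re (ip k k)" if "k \<in> H" for k
    using ip_nonneg[OF that] by (auto simp: nonneg_Reals_def)
  have q: "0 \<le> ?c + 2 * r * ?b + r^2 * ?a" for r :: real
    using nn[OF add_mem[OF f scale_mem[OF g, of "of_real r"]]] Re_ip_expand[OF f g, of r] by simp
  have "?b^2 \<le> ?c * ?a"
  proof (cases "?a = 0")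
    case True
    have "?b = 0"
    proof (rule ccontr)
      assume "?b \<noteq> 0"
      then show False using q[of "-(?c + 1) / (2 * ?b)"] True by (simp add: field_simps)
    qed
    then show ?thesis using True by simp
  next
    case False
    then have "?a > 0" using nn[OF g] by simp
    then show ?thesis using q[of "- ?b / ?a"]
      by (simp add: field_simps power2_eq_square)
  qed
  then show ?thesis
    unfolding ip_norm_def real_sqrt_mult[symmetric] by (rule real_le_rsqrt)
qed

lemma ip_norm_triangle:
  assumes f: "f \<in> H" and g: "g \<in> H"
  shows "ip_norm ip (\<lambda>x. f x + g x) \<le> ip_norm ip f + ip_norm ip g"
proof -
  have nn: "0 \<le> Re (ip k k)" if "k \<in> H" for k
    using ip_nonneg[OF that] by (auto simp: nonneg_Reals_def)
  have "(ip_norm ip (\<lambda>x. f x + g x))^2 \<le> (ip_norm ip f + ip_norm ip g)^2"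
    using Re_ip_expand[OF f g, of 1] Cauchy_Schwarz_Re[OF f g] nn[OF f] nn[OF g]
      nn[OF add_mem[OF f g]]
    by (simp add: ip_norm_def power2_sum)
  then show ?thesis
    by (rule power2_le_imp_le) (use ip_norm_nonneg f g in \<open>auto intro: add_nonneg_nonneg\<close>)
qed

lemma ip_norm_minus_commute:
  assumes f: "f \<in> H" and g: "g \<in> H"
  shows "ip_norm ip (\<lambda>x. f x - g x) = ip_norm ip (\<lambda>x. g x - f x)"
proof -
  have z: "Re (ip (\<lambda>x. 0) k) = 0" "Re (ip k (\<lambda>x. 0)) = 0" if "k \<in> H" for k
    using ip_scale_left[OF that that, of 0] ip_cnj[OF zero_mem that] by simp_all
  show ?thesis
    using Re_ip_expand[OF zero_mem diff_mem[OF f g], of "-1"]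
      z[OF zero_mem] z[OF diff_mem[OF f g]]
    by (simp add: ip_norm_def vector_sneg_minus1[symmetric])
qed

lemma Metric_space_ip_dist: "Metric_space H (ip_dist H ip)"
proof
  fix f g h
  show "0 \<le> ip_dist H ip f g"
    using ip_norm_nonneg diff_mem by (simp add: ip_dist_def)
  show "ip_dist H ip f g = ip_dist H ip g f"
    using ip_norm_minus_commute[of f g] by (auto simp: ip_dist_def)
  { assume f: "f \<in> H" and g: "g \<in> H"
    have "ip_norm ip (\<lambda>x. f x - g x) = 0 \<longleftrightarrow> ip (\<lambda>x. f x - g x) (\<lambda>x. f x - g x) = 0"
      using ip_nonneg[OF diff_mem[OF f g]] by (auto simp: ip_norm_def nonneg_Reals_def)
    also have "\<dots> \<longleftrightarrow> (\<lambda>x. f x - g x) = (\<lambda>x. 0)"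
      using ip_definite[OF diff_mem[OF f g]] ip_scale_left[OF zero_mem zero_mem, of 0] by auto
    finally show "ip_dist H ip f g = 0 \<longleftrightarrow> f = g"
      using f g by (auto simp: ip_dist_def fun_eq_iff)
    assume h: "h \<in> H"
    show "ip_dist H ip f h \<le> ip_dist H ip f g + ip_dist H ip g h"
      using ip_norm_triangle[OF diff_mem[OF f g] diff_mem[OF g h]] f g h
      by (simp add: ip_dist_def) }
qed

end

lemma matrix_vector_mult_axis_sum:
  fixes A :: "complex ^ 'n ^ 'n"
  shows "A *v y = (\<Sum>j\<in>UNIV. y $ j *s (A *v axis j 1))"
proof -
  have "A *v axis j 1 = column j A" for j
    by (simp add: vec_eq_iff matrix_vector_mult_def column_def axis_def
        if_distrib[of "\<lambda>z. _ * z"] cong: if_cong)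
  then show ?thesis by (simp add: matrix_mult_sum)
qed

context rkhs
begin

lemma kernel_fun_mem_all:
  assumes x: "x \<in> X"
  shows "kernel_fun X K x y \<in> H"
proof -
  have "(\<lambda>s. \<Sum>j\<in>J. y $ j *s kernel_fun X K x (axis j 1) s) \<in> H" for J :: "'n set"
  proof (induction J rule: infinite_finite_induct)
    case (insert j J)
    then show ?case using add_mem[OF scale_mem[OF kernel_fun_mem[OF x]] insert.IH] by simp
  qed (simp_all add: zero_mem)
  moreover have "kernel_fun X K x y = (\<lambda>s. \<Sum>j\<in>UNIV. y $ j *s kernel_fun X K x (axis j 1) s)"
    using matrix_vector_mult_axis_sum[of "K _ x" y] by (auto simp: fun_eq_iff kernel_fun_def)
  ultimately show ?thesis by simp
qed

lemma bdd_above_kernel_dist: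
  assumes x: "x \<in> X" and t: "t \<in> X"
  shows "bdd_above ((\<lambda>y. ip_norm ip (\<lambda>s. kernel_fun X K x y s - kernel_fun X K t y s))
           ` {y. norm y \<le> 1})"
proof -
  define D where "D z y = (\<lambda>s. y *s (kernel_fun X K x (axis z 1) s - kernel_fun X K t (axis z 1) s))"
    for z :: 'n and y :: complex
  define B where "B = (\<Sum>z\<in>UNIV. ip_norm ip (D z 1))"
  have mem: "D z y \<in> H" for z y
    unfolding D_def using scale_mem[OF diff_mem[OF kernel_fun_mem[OF x] kernel_fun_mem[OF t]]] .
  have D_norm: "ip_norm ip (D z y) \<le> ip_norm ip (D z 1)" if "norm y \<le> 1" for z y
  proof -
    have D: "D z y = (\<lambda>s. y *s D z 1 s)" by (simp add: D_def)
    have "ip (D z y) (D z y) = y * cnj (ip (D z y) (D z 1))"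
      using ip_scale_left[OF mem mem, of y z 1 z y] ip_cnj[OF mem mem, of z y z 1]
      unfolding D[symmetric] by simp
    also have "ip (D z y) (D z 1) = y * ip (D z 1) (D z 1)"
      using ip_scale_left[OF mem mem, of y z 1 z 1] unfolding D[symmetric] .
    finally have "ip (D z y) (D z y) = (y * cnj y) * ip (D z 1) (D z 1)"
      using ip_cnj[OF mem mem, of z 1 z 1] by simp
    then have "Re (ip (D z y) (D z y)) = (norm y)^2 * Re (ip (D z 1) (D z 1))"
      by (simp add: complex_norm_square[symmetric] del: of_real_power)
    moreover have "0 \<le> Re (ip (D z 1) (D z 1))"
      using ip_nonneg[OF mem[of z 1]] by (auto simp: nonneg_Reals_def)
    ultimately show ?thesis
      using that by (auto simp: ip_norm_def intro!: mult_left_le_one_le power_le_one)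
  qed
  have sum_le: "(\<lambda>s. \<Sum>z\<in>J. D z (y $ z) s) \<in> H \<and>
      ip_norm ip (\<lambda>s. \<Sum>z\<in>J. D z (y $ z) s) \<le> (\<Sum>z\<in>J. ip_norm ip (D z 1))"
    if y: "norm y \<le> 1" for y and J :: "'n set"
  proof (induction J rule: infinite_finite_induct)
    case (insert j J)
    then show ?case
      using add_mem[OF mem[of j "y $ j"]] ip_norm_triangle[OF mem[of j "y $ j"]]
        D_norm[of "y $ j" j] Finite_Cartesian_Product.norm_nth_le[of y j] y by force
  next
    case empty
    show ?case using zero_mem ip_scale_left[OF zero_mem zero_mem, of 0] by (simp add: ip_norm_def)
  next
    case (infinite J)
    then show ?case using finite[of J] by blast
  qed
  have eq: "(\<lambda>s. kernel_fun X K x y s - kernel_fun X K t y s) = (\<lambda>s. \<Sum>z\<in>UNIV. D z (y $ z) s)" for y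
    using matrix_vector_mult_axis_sum[of "K _ x" y] matrix_vector_mult_axis_sum[of "K _ t" y]
    by (auto simp: D_def fun_eq_iff kernel_fun_def vector_ssub_ldistrib sum_subtractf)
  show ?thesis
    using sum_le[of _ UNIV] unfolding eq by (intro bdd_aboveI2[where M = B]) (auto simp: B_def)
qed

lemma kernel_dist_self: "kernel_dist X ip K x x = 0"
proof -
  have "ip_norm ip (\<lambda>s. 0) = 0"
    using ip_scale_left[OF zero_mem zero_mem, of 0] by (simp add: ip_norm_def)
  moreover have "{y :: complex ^ 'n. norm y \<le> 1} \<noteq> {}" by (auto intro: exI[of _ 0])
  ultimately show ?thesis by (simp add: kernel_dist_def)
qed

lemma kernel_dist_commute:
  assumes "x \<in> X" "t \<in> X"
  shows "kernel_dist X ip K x t = kernel_dist X ip K t x"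
  unfolding kernel_dist_def
  using ip_norm_minus_commute[OF kernel_fun_mem_all kernel_fun_mem_all] assms by simp

lemma kernel_dist_triangle:
  assumes x: "x \<in> X" and t: "t \<in> X" and u: "u \<in> X"
  shows "kernel_dist X ip K x u \<le> kernel_dist X ip K x t + kernel_dist X ip K t u"
  unfolding kernel_dist_def[of X ip K x u]
proof (rule cSUP_least)
  show "{y :: complex ^ 'n. norm y \<le> 1} \<noteq> {}" by (auto intro: exI[of _ 0])
next
  fix y :: "complex ^ 'n" assume y: "y \<in> {y. norm y \<le> 1}"
  let ?k = "\<lambda>x. kernel_fun X K x y"
  have "ip_norm ip (\<lambda>s. ?k x s - ?k u s)
      \<le> ip_norm ip (\<lambda>s. ?k x s - ?k t s) + ip_norm ip (\<lambda>s. ?k t s - ?k u s)"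
    using ip_norm_triangle[OF diff_mem[OF kernel_fun_mem_all[OF x, of y] kernel_fun_mem_all[OF t, of y]]
        diff_mem[OF kernel_fun_mem_all[OF t, of y] kernel_fun_mem_all[OF u, of y]]] by simp
  also have "\<dots> \<le> kernel_dist X ip K x t + kernel_dist X ip K t u"
    unfolding kernel_dist_def
    by (intro add_mono cSUP_upper y bdd_above_kernel_dist x t u)
  finally show "ip_norm ip (\<lambda>s. ?k x s - ?k u s) \<le> kernel_dist X ip K x t + kernel_dist X ip K t u" .
qed

lemma openin_kernel_topology:
  "openin (kernel_topology X ip K) =
     arbitrary union_of (\<lambda>B. \<exists>x\<in>X. \<exists>r>0. B = kernel_ball X ip K x r)"
proof -
  let ?P = "\<lambda>B. \<exists>x\<in>X. \<exists>r>0. B = kernel_ball X ip K x r"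
  have "(arbitrary union_of ?P) (kernel_ball X ip K x r \<inter> kernel_ball X ip K x' r')"
    if x: "x \<in> X" and x': "x' \<in> X" for x x' r r'
    unfolding arbitrary_union_of_alt
  proof
    fix z assume "z \<in> kernel_ball X ip K x r \<inter> kernel_ball X ip K x' r'"
    then have z: "z \<in> X" "kernel_dist X ip K x z < r" "kernel_dist X ip K x' z < r'"
      by (auto simp: kernel_ball_def)
    define e where "e = min (r - kernel_dist X ip K x z) (r' - kernel_dist X ip K x' z)"
    have e: "e > 0" using z by (simp add: e_def)
    have "z \<in> kernel_ball X ip K z e" using e z by (simp add: kernel_ball_def kernel_dist_self)
    moreover have "kernel_ball X ip K z e \<subseteq> kernel_ball X ip K x r \<inter> kernel_ball X ip K x' r'"
    proof
      fix w assume w: "w \<in> kernel_ball X ip K z e"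
      then have "w \<in> X" by (simp add: kernel_ball_def)
      with kernel_dist_triangle[OF x z(1)] kernel_dist_triangle[OF x' z(1)] w
      show "w \<in> kernel_ball X ip K x r \<inter> kernel_ball X ip K x' r'"
        by (force simp: kernel_ball_def e_def)
    qed
    ultimately show "\<exists>U. ?P U \<and> z \<in> U \<and> U \<subseteq> kernel_ball X ip K x r \<inter> kernel_ball X ip K x' r'"
      using z(1) e by blast
  qed
  then have "istopology (arbitrary union_of ?P)"
    unfolding istopology_base_eq by blast
  then show ?thesis by (simp add: kernel_topology_def topology_inverse')
qed

lemma topspace_kernel_topology: "topspace (kernel_topology X ip K) = X"
proof
  show "topspace (kernel_topology X ip K) \<subseteq> X"
    using openin_topspace[of "kernel_topology X ip K"]
    unfolding openin_kernel_topology arbitrary_union_of_alt by (fastforce simp: kernel_ball_def)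
  show "X \<subseteq> topspace (kernel_topology X ip K)"
  proof
    fix x assume x: "x \<in> X"
    then have "openin (kernel_topology X ip K) (kernel_ball X ip K x 1)"
      unfolding openin_kernel_topology by (intro arbitrary_union_of_inc) (auto intro!: exI[of _ 1])
    moreover have "x \<in> kernel_ball X ip K x 1" using x by (simp add: kernel_ball_def kernel_dist_self)
    ultimately show "x \<in> topspace (kernel_topology X ip K)" using openin_subset by blast
  qed
qed

end

end

theory Submission
  imports Defs
begin

text \<open>
  Put \<open>k\<^sub>x\<^sup>j = K\<^sub>x e\<^sub>j\<close>. Everything rests on replacing the given pseudo-metric, a supremum over the
  unit ball of \<open>\<complex>\<^sup>n\<close>, by the finite sum \<open>\<rho>(x, t) = \<Sum>\<^sub>j \<parallel>k\<^sub>x\<^sup>j - k\<^sub>t\<^sup>j\<parallel>\<close>, called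
  \<open>section_dist\<close> below. The two are equivalent up to the factors \<open>1\<close> and \<open>n\<close>, so they define the same
  topology (\<open>openin_kernel_topology_iff\<close>), and \<open>\<rho>\<close> is the pull-back of a metric
  on \<open>H\<^sup>n\<close> under \<open>x \<mapsto> (k\<^sub>x\<^sup>1, \<dots>, k\<^sub>x\<^sup>n)\<close>.

  Since \<open>H\<close> is separable, so is every subset of \<open>H\<^sup>n\<close>; hence \<open>X\<close> has a countable \<open>\<rho>\<close>-dense subset, and
  the \<open>\<rho>\<close>-balls of radius \<open>1 / (k + 1)\<close> around it form a countable base
  (\<open>countable_section_ball_base\<close>). The entries of the kernel
  are the inner products \<open>K(x, t)\<^sub>i\<^sub>j = \<langle>k\<^sub>t\<^sup>j, k\<^sub>x\<^sup>i\<rangle>\<close>, so \<open>K\<close> is continuous by the Cauchy--Schwarz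
  inequality.

  Expanding the square gives
  \<open>\<parallel>k\<^sub>x\<^sup>j - k\<^sub>t\<^sup>j\<parallel>\<^sup>2 = K(x, x)\<^sub>j\<^sub>j - 2 Re K(x, t)\<^sub>j\<^sub>j + K(t, t)\<^sub>j\<^sub>j\<close>, which is a measurable function of \<open>t\<close> as
  soon as \<open>K\<close> is measurable. So the \<open>\<rho>\<close>-balls are measurable, and since every open set is a countable
  union of basic balls, so is the whole Borel \<open>\<sigma>\<close>-algebra.

  Finally, in a second countable space whose open sets are measurable, the union of all null open
  sets is a union of countably many null basic open sets, hence null; its complement is the
  required smallest closed set of full measure (\<open>ex1_least_closed_full_measure\<close>).
\<close>

section \<open>The support of a finite measure on a second countable space\<close>

text \<open>
  The union of all null open sets would in general be an uncountable union. A countable base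
  repairs this: every null open set is covered by the null members of the base.
\<close>

lemma ex1_least_closed_full_measure:
  assumes "second_countable T" and fin: "finite_measure M" and top: "topspace T = space M"
    and meas: "\<And>U. openin T U \<Longrightarrow> U \<in> sets M"
  shows "\<exists>!C. closedin T C \<and> measure M C = measure M (space M) \<and>
           (\<forall>C'. closedin T C' \<and> measure M C' = measure M (space M) \<longrightarrow> C \<subseteq> C')"
proof -
  interpret finite_measure M by (rule fin)
  obtain \<B> where cnt: "countable \<B>" and opn: "\<And>V. V \<in> \<B> \<Longrightarrow> openin T V"
    and base: "\<And>U x. openin T U \<Longrightarrow> x \<in> U \<Longrightarrow> \<exists>V\<in>\<B>. x \<in> V \<and> V \<subseteq> U"
    using assms(1) unfolding second_countable_def by metis
  define N where "N = {V \<in> \<B>. V \<in> null_sets M}"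
  define C where "C = space M - \<Union>N"
  have "countable N" by (rule countable_subset[OF _ cnt]) (simp add: N_def)
  then have "(\<Union>V\<in>N. V) \<in> null_sets M" by (rule null_sets_UN') (simp add: N_def)
  then have null: "\<Union>N \<in> null_sets M" by simp
  have "openin T (\<Union>N)" using opn by (auto simp: N_def)
  then have cl: "closedin T C" unfolding C_def top[symmetric] by (rule closedin_diff[OF closedin_topspace])
  have full: "measure M C = measure M (space M)"
    unfolding C_def by (rule measure_Diff_null_set[OF sets.top null])
  have least: "C \<subseteq> C'" if C': "closedin T C'" "measure M C' = measure M (space M)" for C'
  proof -
    have o: "openin T (space M - C')" using C'(1) by (simp add: closedin_def top)
    have sub: "C' \<subseteq> space M" using closedin_subset[OF C'(1)] by (simp add: top)
    have C'_sets: "C' \<in> sets M"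
      using sets.compl_sets[OF meas[OF o]] sub by (simp add: double_diff)
    have "measure M (space M - C') = 0" using finite_measure_compl[OF C'_sets] C'(2) by simp
    then have 0: "space M - C' \<in> null_sets M"
      using meas[OF o] by (simp add: null_sets_def emeasure_eq_measure)
    have "x \<in> \<Union>N" if x: "x \<in> space M - C'" for x
    proof -
      obtain V where V: "V \<in> \<B>" "x \<in> V" "V \<subseteq> space M - C'" using base[OF o x] by blast
      then have "V \<in> null_sets M" using null_sets_subset[OF 0] meas[OF opn] by blast
      then show ?thesis using V by (auto simp: N_def)
    qed
    then show ?thesis by (auto simp: C_def)
  qed
  show ?thesis
    by (rule ex1I[of _ C]) (use cl full least in \<open>auto intro: subset_antisym\<close>)
qed

section \<open>Inner products of functions\<close>

context hilbert_function_space
begin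

lemma ip_diff_left:
  assumes "f \<in> H" "g \<in> H" "h \<in> H"
  shows "ip (\<lambda>x. f x - g x) h = ip f h - ip g h"
  using ip_add_left[OF assms(1) scale_mem[OF assms(2), of "-1"] assms(3)]
    ip_scale_left[OF assms(2,3), of "-1"]
  by (simp add: vector_sneg_minus1[symmetric])

lemma ip_diff_right:
  assumes "f \<in> H" "g \<in> H" "h \<in> H"
  shows "ip h (\<lambda>x. f x - g x) = ip h f - ip h g"
  using ip_diff_left[OF assms] ip_cnj[OF diff_mem[OF assms(1,2)] assms(3)]
    ip_cnj[OF assms(1,3)] ip_cnj[OF assms(2,3)] by simp

lemma ip_norm_scale:
  assumes f: "f \<in> H"
  shows "ip_norm ip (\<lambda>x. c *s f x) = norm c * ip_norm ip f"
proof -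
  have "ip (\<lambda>x. c *s f x) (\<lambda>x. c *s f x) = (c * cnj c) * ip f f"
    using ip_scale_left[OF f scale_mem[OF f]] ip_scale_left[OF f f]
      ip_cnj[OF scale_mem[OF f] f] ip_cnj[OF f f] by simp
  then have "Re (ip (\<lambda>x. c *s f x) (\<lambda>x. c *s f x)) = (norm c)\<^sup>2 * Re (ip f f)"
    by (simp add: complex_norm_square[symmetric] del: of_real_power)
  then show ?thesis by (simp add: ip_norm_def real_sqrt_mult)
qed

text \<open>
  Multiplying \<open>f\<close> by a suitable phase makes \<open>ip f g\<close> real and non-negative without changing the norm
  of \<open>f\<close>, so the bound on the real part is a bound on the modulus.
\<close>

lemma Cauchy_Schwarz:
  assumes f: "f \<in> H" and g: "g \<in> H"
  shows "norm (ip f g) \<le> ip_norm ip f * ip_norm ip g"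
proof (cases "ip f g = 0")
  case True
  then show ?thesis using ip_norm_nonneg f g by simp
next
  case False
  define c where "c = cnj (sgn (ip f g))"
  have "ip (\<lambda>x. c *s f x) g = of_real (norm (ip f g))"
    using False unfolding ip_scale_left[OF f g] c_def
    by (simp add: sgn_eq complex_norm_square[symmetric] power2_eq_square mult.commute[of "cnj _"])
  then have "norm (ip f g) \<le> ip_norm ip (\<lambda>x. c *s f x) * ip_norm ip g"
    using Cauchy_Schwarz_Re[OF scale_mem[OF f] g, of c] by simp
  also have "norm c = 1" using False by (simp add: c_def norm_sgn)
  then have "ip_norm ip (\<lambda>x. c *s f x) = ip_norm ip f" by (simp add: ip_norm_scale[OF f])
  finally show ?thesis .
qed

text \<open>
  The increment of \<open>ip\<close> is expanded around \<open>(f, g)\<close>, so that apart from distances only the norms of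
  the fixed point \<open>(f, g)\<close> occur; this gives continuity at \<open>(f, g)\<close> without bounding \<open>f'\<close> and \<open>g'\<close>.
\<close>

lemma norm_ip_diff_le:
  assumes f: "f \<in> H" "f' \<in> H" and g: "g \<in> H" "g' \<in> H"
  shows "norm (ip f' g' - ip f g)
    \<le> ip_dist H ip f f' * ip_dist H ip g g' + ip_dist H ip f f' * ip_norm ip g
      + ip_norm ip f * ip_dist H ip g g'"
proof -
  let ?u = "\<lambda>x. f' x - f x" and ?v = "\<lambda>x. g' x - g x"
  have u: "?u \<in> H" and v: "?v \<in> H" using diff_mem f g by auto
  have "norm (ip f' g' - ip f g) = norm (ip ?u ?v + ip ?u g + ip f ?v)"
    using ip_diff_left[OF f(2,1) g(1)] ip_diff_left[OF f(2,1) g(2)]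
      ip_diff_right[OF g(2,1) f(1)] ip_diff_right[OF g(2,1) u] by simp
  also have "\<dots> \<le> norm (ip ?u ?v) + norm (ip ?u g) + norm (ip f ?v)"
    by (rule order_trans[OF norm_triangle_ineq add_right_mono[OF norm_triangle_ineq]])
  also have "\<dots> \<le> ip_norm ip ?u * ip_norm ip ?v + ip_norm ip ?u * ip_norm ip g
      + ip_norm ip f * ip_norm ip ?v"
    using Cauchy_Schwarz[OF u v] Cauchy_Schwarz[OF u g(1)] Cauchy_Schwarz[OF f(1) v] by linarith
  finally show ?thesis
    using ip_norm_minus_commute[OF f] ip_norm_minus_commute[OF g] f g by (simp add: ip_dist_def)
qed

end

section \<open>An equivalent pseudo-metric on the domain of the kernel\<close>

context rkhs
begin

abbreviation section_fun :: "'x \<Rightarrow> 'n \<Rightarrow> 'x \<Rightarrow> complex ^ 'n" where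
  "section_fun x j \<equiv> kernel_fun X K x (axis j 1)"

definition section_dist :: "'x \<Rightarrow> 'x \<Rightarrow> real" where
  "section_dist x t = (\<Sum>j\<in>UNIV. ip_dist H ip (section_fun x j) (section_fun t j))"

lemma section_dist_nonneg: "0 \<le> section_dist x t"
  unfolding section_dist_def
  by (intro sum_nonneg Metric_space.nonneg[OF Metric_space_ip_dist])

lemma section_dist_commute: "section_dist x t = section_dist t x"
  unfolding section_dist_def by (simp add: Metric_space.commute[OF Metric_space_ip_dist])

lemma section_dist_self: "x \<in> X \<Longrightarrow> section_dist x x = 0"
  unfolding section_dist_def
  by (simp add: Metric_space.mdist_zero[OF Metric_space_ip_dist] kernel_fun_mem)

lemma section_dist_triangle:
  assumes "x \<in> X" "t \<in> X" "u \<in> X"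
  shows "section_dist x u \<le> section_dist x t + section_dist t u"
  unfolding section_dist_def sum.distrib[symmetric]
  by (intro sum_mono Metric_space.triangle[OF Metric_space_ip_dist] kernel_fun_mem assms)

lemma ip_dist_le_section_dist:
  "ip_dist H ip (section_fun x j) (section_fun t j) \<le> section_dist x t"
  unfolding section_dist_def
  by (rule member_le_sum) (auto intro: Metric_space.nonneg[OF Metric_space_ip_dist])

text \<open>
  A vector \<open>y\<close> of the unit ball has coordinates of modulus at most \<open>1\<close>, and
  \<open>K\<^sub>x y - K\<^sub>t y = \<Sum>\<^sub>j y\<^sub>j (K\<^sub>x e\<^sub>j - K\<^sub>t e\<^sub>j)\<close>.
\<close>

lemma kernel_dist_le_section_dist:
  assumes x: "x \<in> X" and t: "t \<in> X"
  shows "kernel_dist X ip K x t \<le> section_dist x t"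
  unfolding kernel_dist_def
proof (rule cSUP_least)
  show "{y :: complex ^ 'n. norm y \<le> 1} \<noteq> {}" by (auto intro: exI[of _ 0])
next
  fix y :: "complex ^ 'n" assume "y \<in> {y. norm y \<le> 1}"
  then have y: "norm (y $ j) \<le> 1" for j
    using Finite_Cartesian_Product.norm_nth_le[of y j] by simp
  let ?d = "\<lambda>j s. section_fun x j s - section_fun t j s"
  have d: "?d j \<in> H" for j by (intro diff_mem kernel_fun_mem x t)
  have "(\<lambda>s. \<Sum>j\<in>J. y $ j *s ?d j s) \<in> H \<and>
      ip_norm ip (\<lambda>s. \<Sum>j\<in>J. y $ j *s ?d j s) \<le> (\<Sum>j\<in>J. ip_norm ip (?d j))" for J :: "'n set"
  proof (induction J rule: finite_induct[OF finite])
    case 1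
    show ?case using zero_mem ip_scale_left[OF zero_mem zero_mem, of 0] by (simp add: ip_norm_def)
  next
    case (2 j J)
    have "ip_norm ip (\<lambda>s. y $ j *s ?d j s) \<le> ip_norm ip (?d j)"
      unfolding ip_norm_scale[OF d] using y ip_norm_nonneg[OF d] by (simp add: mult_left_le_one_le)
    moreover have J: "(\<lambda>s. \<Sum>j\<in>J. y $ j *s ?d j s) \<in> H"
      "ip_norm ip (\<lambda>s. \<Sum>j\<in>J. y $ j *s ?d j s) \<le> (\<Sum>j\<in>J. ip_norm ip (?d j))"
      using 2 by auto
    ultimately show ?case
      using 2(1) add_mem[OF scale_mem[OF d] J(1), of "y $ j" j]
        ip_norm_triangle[OF scale_mem[OF d] J(1), of "y $ j" j]
      by (simp add: 2(2))
  qed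
  moreover have "(\<lambda>s. kernel_fun X K x y s - kernel_fun X K t y s) = (\<lambda>s. \<Sum>j\<in>UNIV. y $ j *s ?d j s)"
    using matrix_vector_mult_axis_sum[of "K _ x" y] matrix_vector_mult_axis_sum[of "K _ t" y]
    by (auto simp: fun_eq_iff kernel_fun_def vector_ssub_ldistrib sum_subtractf)
  ultimately show "ip_norm ip (\<lambda>s. kernel_fun X K x y s - kernel_fun X K t y s) \<le> section_dist x t"
    by (simp add: section_dist_def ip_dist_def kernel_fun_mem x t)
qed

lemma section_dist_le_kernel_dist:
  assumes x: "x \<in> X" and t: "t \<in> X"
  shows "section_dist x t \<le> real CARD('n) * kernel_dist X ip K x t"
proof -
  have "ip_dist H ip (section_fun x j) (section_fun t j) \<le> kernel_dist X ip K x t" for j :: 'n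
  proof -
    have "norm (axis j 1 :: complex ^ 'n) \<le> 1" by (simp add: norm_eq_sqrt_inner inner_axis_axis)
    then have "ip_norm ip (\<lambda>s. section_fun x j s - section_fun t j s) \<le> kernel_dist X ip K x t"
      unfolding kernel_dist_def by (intro cSUP_upper bdd_above_kernel_dist x t) simp
    then show ?thesis by (simp add: ip_dist_def kernel_fun_mem x t)
  qed
  then show ?thesis unfolding section_dist_def by (intro sum_bounded_above)
qed

lemma openin_kernel_topology_iff:
  "openin (kernel_topology X ip K) U \<longleftrightarrow>
     U \<subseteq> X \<and> (\<forall>x\<in>U. \<exists>r>0. \<forall>t\<in>X. section_dist x t < r \<longrightarrow> t \<in> U)"
proof
  assume U: "openin (kernel_topology X ip K) U"
  then have UX: "U \<subseteq> X" using openin_subset topspace_kernel_topology by blast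
  have "\<exists>r>0. \<forall>t\<in>X. section_dist x t < r \<longrightarrow> t \<in> U" if x: "x \<in> U" for x
  proof -
    obtain c r where c: "c \<in> X" "x \<in> kernel_ball X ip K c r" "kernel_ball X ip K c r \<subseteq> U"
      using U x unfolding openin_kernel_topology arbitrary_union_of_alt by blast
    have "t \<in> U" if t: "t \<in> X" "section_dist x t < r - kernel_dist X ip K c x" for t
      using kernel_dist_triangle[OF c(1) _ t(1), of x] kernel_dist_le_section_dist[OF _ t(1), of x]
        t x UX c(3) by (force simp: kernel_ball_def)
    then show ?thesis using c(2) by (intro exI[of _ "r - kernel_dist X ip K c x"]) (auto simp: kernel_ball_def)
  qed
  with UX show "U \<subseteq> X \<and> (\<forall>x\<in>U. \<exists>r>0. \<forall>t\<in>X. section_dist x t < r \<longrightarrow> t \<in> U)" by blast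
next
  assume U: "U \<subseteq> X \<and> (\<forall>x\<in>U. \<exists>r>0. \<forall>t\<in>X. section_dist x t < r \<longrightarrow> t \<in> U)"
  show "openin (kernel_topology X ip K) U"
    unfolding openin_kernel_topology arbitrary_union_of_alt
  proof
    fix x assume x: "x \<in> U"
    then have xX: "x \<in> X" using U by blast
    obtain r where r: "r > 0" "\<And>t. t \<in> X \<Longrightarrow> section_dist x t < r \<Longrightarrow> t \<in> U" using U x by blast
    let ?B = "kernel_ball X ip K x (r / real CARD('n))"
    have "t \<in> U" if t: "t \<in> ?B" for t
    proof (rule r(2))
      show tX: "t \<in> X" using t by (simp add: kernel_ball_def)
      have "real CARD('n) * kernel_dist X ip K x t < r"
        using t by (simp add: kernel_ball_def field_simps)
      then show "section_dist x t < r" using section_dist_le_kernel_dist[OF xX tX] by simp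
    qed
    moreover have "x \<in> ?B" using xX r by (simp add: kernel_ball_def kernel_dist_self)
    ultimately show "\<exists>B. (\<exists>x\<in>X. \<exists>r>0. B = kernel_ball X ip K x r) \<and> x \<in> B \<and> B \<subseteq> U"
      using xX r(1) by (intro exI[of _ ?B]) (auto intro!: bexI[of _ x] exI[of _ "r / real CARD('n)"])
  qed
qed

definition section_ball :: "'x \<Rightarrow> real \<Rightarrow> 'x set" where
  "section_ball x r = {t \<in> X. section_dist x t < r}"

lemma openin_section_ball:
  assumes x: "x \<in> X"
  shows "openin (kernel_topology X ip K) (section_ball x r)"
  unfolding openin_kernel_topology_iff
proof (intro conjI ballI)
  fix u assume u: "u \<in> section_ball x r"
  then have "t \<in> section_ball x r" if "t \<in> X" "section_dist u t < r - section_dist x u" for t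
    using section_dist_triangle[OF x _ that(1), of u] that by (simp add: section_ball_def)
  then show "\<exists>e>0. \<forall>t\<in>X. section_dist u t < e \<longrightarrow> t \<in> section_ball x r"
    using u by (intro exI[of _ "r - section_dist x u"]) (auto simp: section_ball_def)
qed (auto simp: section_ball_def)

section \<open>A countable base\<close>

text \<open>
  A countable dense set \<open>S\<close> of \<open>H\<close> need not contain any \<open>section_fun x j\<close>. Instead one chooses,
  for every \<open>s \<in> S\<^sup>n\<close> and every \<open>k\<close>, one point of \<open>X\<close> whose sections are within \<open>1 / (k + 1)\<close> of \<open>s\<close>,
  if there is one.
\<close>

lemma countable_section_dense:
  assumes "separable_space (Metric_space.mtopology H (ip_dist H ip))"
  obtains D where "countable D" "D \<subseteq> X" "\<And>x e. x \<in> X \<Longrightarrow> e > 0 \<Longrightarrow> \<exists>t\<in>D. section_dist x t < e"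
proof -
  interpret MH: Metric_space H "ip_dist H ip" by (rule Metric_space_ip_dist)
  obtain S where S: "countable S" "S \<subseteq> H" "MH.mtopology closure_of S = H"
    using assms unfolding separable_space_def by auto
  define near where "near = (\<lambda>(s :: 'n \<Rightarrow> 'x \<Rightarrow> complex ^ 'n, k :: nat) t.
    t \<in> X \<and> (\<forall>j. ip_dist H ip (section_fun t j) (s j) < inverse (real (Suc k))))"
  define P where "P = {p \<in> (UNIV \<rightarrow>\<^sub>E S) \<times> (UNIV :: nat set). \<exists>t. near p t}"
  define D where "D = (\<lambda>p. SOME t. near p t) ` P"
  have choice: "near p (SOME t. near p t)" if "p \<in> P" for p
    using that unfolding P_def by (auto intro: someI)
  have "countable P"
    unfolding P_def by (rule countable_subset[of _ "(UNIV \<rightarrow>\<^sub>E S) \<times> UNIV"])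
      (auto intro!: countable_SIGMA countable_PiE S(1))
  then have "countable D" by (simp add: D_def)
  moreover have "D \<subseteq> X" using choice by (force simp: D_def near_def)
  moreover have "\<exists>t\<in>D. section_dist x t < e" if x: "x \<in> X" and e: "e > 0" for x e
  proof -
    let ?n = "real CARD('n)"
    obtain k where k: "inverse (real (Suc k)) < e / (2 * ?n)"
      using reals_Archimedean[of "e / (2 * ?n)"] e by auto
    define \<epsilon> where "\<epsilon> = inverse (real (Suc k))"
    have "\<exists>f\<in>S. ip_dist H ip (section_fun x j) f < \<epsilon>" for j
    proof -
      have "section_fun x j \<in> MH.mtopology closure_of S" using kernel_fun_mem[OF x] S(3) by simp
      then have "\<forall>r>0. \<exists>f\<in>S. f \<in> MH.mball (section_fun x j) r" by (simp add: MH.metric_closure_of)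
      moreover have "\<epsilon> > 0" by (simp add: \<epsilon>_def)
      ultimately show ?thesis by (meson MH.in_mball)
    qed
    then obtain s where s: "\<And>j. s j \<in> S" "\<And>j. ip_dist H ip (section_fun x j) (s j) < \<epsilon>" by metis
    define t where "t = (SOME t. near (s, k) t)"
    have P: "(s, k) \<in> P" using s x by (auto simp: P_def near_def \<epsilon>_def)
    then have t: "t \<in> X" "\<And>j. ip_dist H ip (section_fun t j) (s j) < \<epsilon>"
      using choice[OF P] by (auto simp: t_def near_def \<epsilon>_def)
    have "ip_dist H ip (section_fun x j) (section_fun t j) \<le> 2 * \<epsilon>" for j
      using MH.triangle'[of "section_fun x j" "s j" "section_fun t j"]
        s(2)[of j] t(2)[of j] s(1)[of j] S(2) kernel_fun_mem[OF x, of j] kernel_fun_mem[OF t(1), of j]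
      by auto
    then have "section_dist x t \<le> ?n * (2 * \<epsilon>)"
      unfolding section_dist_def by (rule sum_bounded_above)
    also have "\<dots> < e" using k unfolding \<epsilon>_def[symmetric] by (simp add: field_simps)
    finally show ?thesis using P by (auto simp: D_def t_def)
  qed
  ultimately show thesis by (rule that)
qed

text \<open>
  That the members of the base are balls matters beyond second countability: the balls are the open
  sets whose measurability can be checked directly.
\<close>

lemma countable_section_ball_base:
  assumes "separable_space (Metric_space.mtopology H (ip_dist H ip))"
  obtains \<B> where "countable \<B>" "\<And>V. V \<in> \<B> \<Longrightarrow> \<exists>x\<in>X. \<exists>r. V = section_ball x r"
    "\<And>U x. openin (kernel_topology X ip K) U \<Longrightarrow> x \<in> U \<Longrightarrow> \<exists>V\<in>\<B>. x \<in> V \<and> V \<subseteq> U"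
proof -
  obtain D where D: "countable D" "D \<subseteq> X"
    "\<And>x e. x \<in> X \<Longrightarrow> e > 0 \<Longrightarrow> \<exists>t\<in>D. section_dist x t < e"
    using countable_section_dense[OF assms] by blast
  define \<B> where "\<B> = (\<lambda>(t, k). section_ball t (inverse (real (Suc k)))) ` (D \<times> UNIV)"
  have "\<exists>V\<in>\<B>. x \<in> V \<and> V \<subseteq> U" if U: "openin (kernel_topology X ip K) U" and x: "x \<in> U" for U x
  proof -
    obtain r where r: "r > 0" "\<And>t. t \<in> X \<Longrightarrow> section_dist x t < r \<Longrightarrow> t \<in> U" and xX: "x \<in> X"
      using U x unfolding openin_kernel_topology_iff by blast
    obtain k where k: "inverse (real (Suc k)) < r / 2" using reals_Archimedean[of "r / 2"] r by auto
    obtain t where t: "t \<in> D" "section_dist x t < inverse (real (Suc k))"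
      using D(3)[OF xX, of "inverse (real (Suc k))"] by auto
    have tX: "t \<in> X" using t D(2) by blast
    let ?V = "section_ball t (inverse (real (Suc k)))"
    have "x \<in> ?V" using t xX by (simp add: section_ball_def section_dist_commute)
    moreover have "?V \<subseteq> U"
    proof
      fix u assume u: "u \<in> ?V"
      then have "u \<in> X" by (simp add: section_ball_def)
      then show "u \<in> U"
        using section_dist_triangle[OF xX tX, of u] u t(2) k
        by (intro r(2)) (auto simp: section_ball_def)
    qed
    ultimately show ?thesis using t(1) by (auto simp: \<B>_def)
  qed
  moreover have "countable \<B>" using D(1) by (simp add: \<B>_def)
  moreover have "\<exists>x\<in>X. \<exists>r. V = section_ball x r" if "V \<in> \<B>" for V
    using that D(2) by (auto simp: \<B>_def)
  ultimately show thesis by (rule that[rotated 2])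
qed

lemma second_countable_kernel_topology:
  assumes "separable_space (Metric_space.mtopology H (ip_dist H ip))"
  shows "second_countable (kernel_topology X ip K)"
proof -
  obtain \<B> where "countable \<B>" "\<And>V. V \<in> \<B> \<Longrightarrow> \<exists>x\<in>X. \<exists>r. V = section_ball x r"
    "\<And>U x. openin (kernel_topology X ip K) U \<Longrightarrow> x \<in> U \<Longrightarrow> \<exists>V\<in>\<B>. x \<in> V \<and> V \<subseteq> U"
    using countable_section_ball_base[OF assms] by blast
  then show ?thesis
    unfolding second_countable_def
    by (intro exI[of _ \<B>]) (fastforce intro: openin_section_ball)
qed

section \<open>Continuity of the kernel\<close>

text \<open>
  Column \<open>j\<close> of \<open>K x t\<close> is the value at \<open>x\<close> of \<open>K\<^sub>t e\<^sub>j\<close>, and the reproducing property turns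
  evaluation at \<open>x\<close> into inner products with the \<open>K\<^sub>x e\<^sub>i\<close>.
\<close>

lemma kernel_entry:
  assumes "x \<in> X" "t \<in> X"
  shows "K x t $ i $ j = ip (section_fun t j) (section_fun x i)"
proof -
  have "K x t $ i $ j = section_fun t j x $ i"
    using assms by (simp add: kernel_fun_def matrix_vector_mult_def axis_def
        if_distrib[of "\<lambda>z. _ * z"] cong: if_cong)
  also have "\<dots> = ip (section_fun t j) (section_fun x i)"
    using reproducing[OF kernel_fun_mem[OF assms(2)] assms(1), of j] by simp
  finally show ?thesis .
qed

lemma section_dist_tendsto_0:
  assumes x: "x \<in> X" and F: "continuous_map T (kernel_topology X ip K) \<phi>"
    and a: "a \<in> topspace T" "\<phi> a = x"
  shows "((\<lambda>p. section_dist x (\<phi> p)) \<longlongrightarrow> 0) (atin T a)"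
proof (rule tendstoI)
  fix e :: real assume e: "e > 0"
  let ?U = "{p \<in> topspace T. \<phi> p \<in> section_ball x e}"
  have "openin T ?U" by (rule openin_continuous_map_preimage[OF F openin_section_ball[OF x]])
  moreover have "a \<in> ?U" using a x e by (simp add: section_ball_def section_dist_self)
  ultimately show "\<forall>\<^sub>F p in atin T a. dist (section_dist x (\<phi> p)) 0 < e"
    unfolding eventually_atin
    by (intro disjI2 exI[of _ ?U]) (auto simp: section_ball_def section_dist_nonneg)
qed

lemma continuous_map_kernel:
  "continuous_map (prod_topology (kernel_topology X ip K) (kernel_topology X ip K)) euclidean
     (\<lambda>(x, t). K x t)"
  (is "continuous_map ?T _ _")
  unfolding continuous_map_atin
proof clarify
  fix x t assume xt: "(x, t) \<in> topspace ?T"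
  then have x: "x \<in> X" and t: "t \<in> X" by (auto simp: topspace_kernel_topology)
  let ?F = "atin ?T (x, t)"
  have dx: "((\<lambda>p. section_dist x (fst p)) \<longlongrightarrow> 0) ?F"
    by (rule section_dist_tendsto_0[OF x continuous_map_fst xt]) simp
  have dt: "((\<lambda>p. section_dist t (snd p)) \<longlongrightarrow> 0) ?F"
    by (rule section_dist_tendsto_0[OF t continuous_map_snd xt]) simp
  have dom: "\<forall>\<^sub>F p in ?F. fst p \<in> X \<and> snd p \<in> X"
    unfolding eventually_atin
    by (intro disjI2 exI[of _ "topspace ?T"] conjI openin_topspace xt)
      (auto simp: topspace_kernel_topology)
  have "((\<lambda>p. (case p of (x, t) \<Rightarrow> K x t) $ i $ j) \<longlongrightarrow> K x t $ i $ j) ?F" for i j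
  proof -
    let ?a = "ip_norm ip (section_fun x i)" and ?b = "ip_norm ip (section_fun t j)"
    let ?d = "\<lambda>p. section_dist t (snd p) * section_dist x (fst p) + section_dist t (snd p) * ?a
      + ?b * section_dist x (fst p)"
    have "(?d \<longlongrightarrow> 0 * 0 + 0 * ?a + ?b * 0) ?F"
      by (intro tendsto_intros dx dt)
    then have lim: "(?d \<longlongrightarrow> 0) ?F" by simp
    have "norm (K x' t' $ i $ j - K x t $ i $ j) \<le> ?d (x', t')" if x': "x' \<in> X" and t': "t' \<in> X" for x' t'
    proof -
      note f = kernel_fun_mem[OF t, of j] kernel_fun_mem[OF t', of j]
        and g = kernel_fun_mem[OF x, of i] kernel_fun_mem[OF x', of i]
      note nonneg = Metric_space.nonneg[OF Metric_space_ip_dist]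
      show ?thesis
        unfolding kernel_entry[OF x t] kernel_entry[OF x' t'] fst_conv snd_conv
        by (intro order_trans[OF norm_ip_diff_le[OF f g]] add_mono mult_mono order_refl
            ip_dist_le_section_dist nonneg section_dist_nonneg ip_norm_nonneg f g)
    qed
    then have "\<forall>\<^sub>F p in ?F. norm ((case p of (x, t) \<Rightarrow> K x t) $ i $ j - K x t $ i $ j) \<le> ?d p"
      by (intro eventually_mono[OF dom]) auto
    then have "((\<lambda>p. (case p of (x, t) \<Rightarrow> K x t) $ i $ j - K x t $ i $ j) \<longlongrightarrow> 0) ?F"
      by (rule Lim_null_comparison[OF _ lim])
    then show ?thesis by (rule LIM_zero_cancel)
  qed
  then show "limitin euclidean (\<lambda>(x, t). K x t) (K x t) ?F"
    unfolding limitin_canonical_iff by (intro vec_tendstoI) simp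
qed

section \<open>Measurability of the open sets\<close>

text \<open>
  On \<open>X\<close> the distance is an explicit expression in the kernel values on the slice \<open>{x} \<times> X\<close> and on
  the diagonal, and both \<open>t \<mapsto> (x, t)\<close> and \<open>t \<mapsto> (t, t)\<close> are measurable.
\<close>

lemma section_dist_eq:
  assumes x: "x \<in> X" and t: "t \<in> X"
  shows "section_dist x t =
    (\<Sum>j\<in>UNIV. sqrt (Re (K x x $ j $ j) - 2 * Re (K x t $ j $ j) + Re (K t t $ j $ j)))"
proof -
  have "ip_dist H ip (section_fun x j) (section_fun t j) =
      sqrt (Re (K x x $ j $ j) - 2 * Re (K x t $ j $ j) + Re (K t t $ j $ j))" for j
    using Re_ip_expand[OF kernel_fun_mem[OF x, of j] kernel_fun_mem[OF t, of j], of "-1"]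
      ip_cnj[OF kernel_fun_mem[OF x, of j] kernel_fun_mem[OF t, of j]]
    by (simp add: ip_dist_def ip_norm_def kernel_fun_mem x t kernel_entry
        vector_sneg_minus1[symmetric])
  then show ?thesis by (simp add: section_dist_def)
qed

lemma section_ball_measurable:
  assumes sp: "space M = X" and K: "(\<lambda>(x, t). K x t) \<in> borel_measurable (M \<Otimes>\<^sub>M M)"
    and x: "x \<in> X"
  shows "section_ball x r \<in> sets M"
proof -
  have entry: "(\<lambda>A :: complex ^ 'n ^ 'n. Re (A $ j $ j)) \<in> borel_measurable borel" for j
    by (intro borel_measurable_continuous_onI continuous_intros)
  have slice: "(\<lambda>t. K x t) \<in> borel_measurable M"
    using measurable_compose[OF measurable_Pair1' K, of x] x sp by simp
  have diag: "(\<lambda>t. K t t) \<in> borel_measurable M"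
    using measurable_compose[OF measurable_Pair[OF measurable_ident measurable_ident] K] by simp
  have "(\<lambda>t. \<Sum>j\<in>UNIV. sqrt (Re (K x x $ j $ j) - 2 * Re (K x t $ j $ j) + Re (K t t $ j $ j)))
      \<in> borel_measurable M"
    using measurable_compose[OF slice entry] measurable_compose[OF diag entry] by measurable
  then have "section_dist x \<in> borel_measurable M"
    by (subst measurable_cong[OF section_dist_eq[OF x]]) (simp_all add: sp)
  then have "{t \<in> space M. section_dist x t < r} \<in> sets M" by measurable
  then show ?thesis by (simp add: section_ball_def sp)
qed

lemma openin_kernel_topology_measurable:
  assumes sep: "separable_space (Metric_space.mtopology H (ip_dist H ip))"
    and sp: "space M = X" and K: "(\<lambda>(x, t). K x t) \<in> borel_measurable (M \<Otimes>\<^sub>M M)"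
    and U: "openin (kernel_topology X ip K) U"
  shows "U \<in> sets M"
proof -
  obtain \<B> where \<B>: "countable \<B>" "\<And>V. V \<in> \<B> \<Longrightarrow> \<exists>x\<in>X. \<exists>r. V = section_ball x r"
    "\<And>U x. openin (kernel_topology X ip K) U \<Longrightarrow> x \<in> U \<Longrightarrow> \<exists>V\<in>\<B>. x \<in> V \<and> V \<subseteq> U"
    using countable_section_ball_base[OF sep] by blast
  have "\<Union>{V \<in> \<B>. V \<subseteq> U} \<in> sets M"
    using \<B>(1,2) section_ball_measurable[OF sp K]
    by (intro sets.countable_Union) (auto intro: countable_subset[of _ \<B>])
  also have "\<Union>{V \<in> \<B>. V \<subseteq> U} = U" using \<B>(3)[OF U] by blast
  finally show ?thesis .
qed

end

section \<open>The topology of a reproducing kernel\<close>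

theorem theorem3p1:
  fixes X :: "'x set"
    and K :: "'x \<Rightarrow> 'x \<Rightarrow> complex ^ 'n ^ 'n"
    and H :: "('x \<Rightarrow> complex ^ 'n) set"
    and ip :: "('x \<Rightarrow> complex ^ 'n) \<Rightarrow> ('x \<Rightarrow> complex ^ 'n) \<Rightarrow> complex"
    and \<tau> :: "'x topology"
  assumes "reproducing_kernel X K"
    and "rkhs X H ip K"
    and "separable_space (Metric_space.mtopology H (ip_dist H ip))"
    and "\<tau> = kernel_topology X ip K"
  shows
    "(second_countable \<tau> \<and> continuous_map (prod_topology \<tau> \<tau>) euclidean (\<lambda>(x, t). K x t)) \<and>
     (\<forall>M :: 'x measure.
        space M = X \<and> (\<lambda>(x, t). K x t) \<in> borel_measurable (M \<Otimes>\<^sub>M M) \<longrightarrow>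
        sigma_sets X {U. openin \<tau> U} \<subseteq> sets M) \<and>
     (\<forall>M :: 'x measure.
        finite_measure M \<and> space M = X \<and>
        (\<lambda>(x, t). K x t) \<in> borel_measurable (M \<Otimes>\<^sub>M M) \<longrightarrow>
        (\<exists>!C. closedin \<tau> C \<and> measure M C = measure M X \<and>
           (\<forall>C'. closedin \<tau> C' \<and> measure M C' = measure M X \<longrightarrow> C \<subseteq> C')))"
proof -
  interpret rkhs X H ip K by (rule assms(2))
  note sep = assms(3) and \<tau> = assms(4)
  have meas: "U \<in> sets M" if "space M = X" "(\<lambda>(x, t). K x t) \<in> borel_measurable (M \<Otimes>\<^sub>M M)" "openin \<tau> U"
    for M U
    using openin_kernel_topology_measurable[OF sep that(1,2)] that(3) by (simp add: \<tau>)
  have sc: "second_countable \<tau>"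
    using second_countable_kernel_topology[OF sep] by (simp add: \<tau>)
  have "sigma_sets X {U. openin \<tau> U} \<subseteq> sets M"
    if M: "space M = X" "(\<lambda>(x, t). K x t) \<in> borel_measurable (M \<Otimes>\<^sub>M M)" for M
    using sets.sigma_sets_subset[of "{U. openin \<tau> U}" M] meas[OF M] M(1) by auto
  moreover have "\<exists>!C. closedin \<tau> C \<and> measure M C = measure M X \<and>
      (\<forall>C'. closedin \<tau> C' \<and> measure M C' = measure M X \<longrightarrow> C \<subseteq> C')"
    if fin: "finite_measure M" and M: "space M = X" "(\<lambda>(x, t). K x t) \<in> borel_measurable (M \<Otimes>\<^sub>M M)" for M
    using ex1_least_closed_full_measure[OF sc fin _ meas[OF M]]
    by (simp add: M(1) \<tau> topspace_kernel_topology)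
  ultimately show ?thesis
    using sc continuous_map_kernel by (auto simp: \<tau>)
qed

end
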